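(* Let $m,n$ be positive integers and let $f:\mathbb{R}^{m\times n}\to\mathbb{R}\cup\{+\infty\}$ be equal to a polynomial on its effective domain $\operatorname{dom} f=\{Z\in\mathbb{R}^{m\times n}: g_1(Z)\ge0,\dots,g_s(Z)\ge0\}$, where $g_1,\dots,g_s$ are polynomials. Let $X\in\mathbb{R}^{m\times n}$. If the optimal value of the moment relaxation satisfies $f_{\rm mom}^{k^*}(X)=f(X)$ for some integer $k^*$ (with $2k^*\ge\max\{\deg f,m,n\}$), then $f_{\rm mom}^k(X)=f_{pc}(X)=f(X)$ for all integers $k\ge k^*$, and $f$ is polyconvex at $X$ (meaning $f_{pc}(X)=f(X)$).
   Context: Let $N=\sum_{j=1}^{\min(m,n)}\binom{m}{j}\binom{n}{j}$ and let $p:\mathbb{R}^{m\times n}\to\mathbb{R}^N$ map a matrix to the list of all its minors of orders $1,\dots,\min(m,n)$. A function $h:\mathbb{R}^{m\times n}\to\mathbb{R}\cup\{+\infty\}$ is polyconvex if $h=g\circ p$ for some convex $g:\mathbb{R}^N\to\mathbb{R}\cup\{+\infty\}$. The polyconvex envelope is $f_{pc}(X)=\sup_h h(X)$ over all polyconvex $h:\mathbb{R}^{m\times n}\to\mathbb{R}\cup\{+\infty\}$ with $h\le f$ everywhere. $\mathbb{R}[Z]_j$ is the space of real polynomials of degree at most $j$ in the entries of $Z\in\mathbb{R}^{m\times n}$, and $\Sigma_k[Z]$ is the cone of finite sums of squares of elements of $\mathbb{R}[Z]_k$. In $\deg f$ and $\ell_y(f)$, $f$ denotes the polynomial that agrees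 with $f$ on $\operatorname{dom} f$. Fix the monomial basis $(Z^a)_{a\in\mathbb{N}^{mn}}$. For $y=(y_a)_{a\in\mathbb{N}^{mn},|a|\le2k}$, let $\ell_y$ be the linear functional on $\mathbb{R}[Z]_{2k}$ given by $\ell_y(\sum_a q_aZ^a)=\sum_a q_ay_a$, applied entrywise to vector-valued polynomials. The pseudo-moment cone $\mathscr{R}^k$ is the set of all such $y$ with $\ell_y(\sigma_0)\ge0$ for all $\sigma_0\in\Sigma_k[Z]$ and $\ell_y(g_i\sigma_i)\ge0$ for all $i\in\{1,\dots,s\}$ and all $\sigma_i\in\Sigma_k[Z]$ with $\deg(g_i\sigma_i)\le2k$. The moment relaxation of order $k$ has optimal value (in $\mathbb{R}\cup\{\pm\infty\}$) $$f_{\rm mom}^k(X)=\inf\{\ell_y(f):\ y\in\mathscr{R}^k,\ \ell_y(1)=1,\ \ell_y(p)=p(X)\}.$$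
   Formalization: The formal theorem also assumes that f has at least one polyconvex minorant; otherwise the supremum defining f_pc is empty and the claim fails, e.g. m=n=1, f(z)=-z^2 on z≥0 (+∞ elsewhere), g_1=z, X=0, k*=2. *)

theory Defs
  imports
    "HOL-Analysis.Analysis"
    "HOL-Library.Poly_Mapping"
    "Jordan_Normal_Form.Determinant"
begin

no_notation Matrix.vec_index (infixl "$" 100)

section \<open>Minors\<close>

text \<open>
  The row and column index types are finite and linearly ordered, so that a choice of rows and
  columns determines a submatrix and hence a signed minor.
\<close>

definition minor :: "('m::{finite,linorder} \<Rightarrow> 'n::{finite,linorder} \<Rightarrow> 'a::comm_ring_1)
    \<Rightarrow> 'm set \<Rightarrow> 'n set \<Rightarrow> 'a" where
  "minor A I J = Determinant.det (Matrix.mat (card I) (card J)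
     (\<lambda>(r, c). A (sorted_list_of_set I ! r) (sorted_list_of_set J ! c)))"

typedef ('m, 'n) minor_index =
  "{(I :: 'm::finite set, J :: 'n::finite set). card I = card J \<and> card I \<ge> 1}"
  by (rule exI[of _ "({undefined}, {undefined})"]) simp

instance minor_index :: (finite, finite) finite
proof
  show "finite (UNIV :: ('a, 'b) minor_index set)"
    by (rule finite_imageD[of Rep_minor_index]) (auto simp: inj_on_def Rep_minor_index_inject)
qed

lemma card_minor_index:
  "CARD(('m::finite, 'n::finite) minor_index) =
     (\<Sum>j=1..min CARD('m) CARD('n). (CARD('m) choose j) * (CARD('n) choose j))"
proof -
  let ?S = "{(I :: 'm set, J :: 'n set). card I = card J \<and> card I \<ge> 1}"
  let ?T = "\<lambda>j. {I :: 'm set. card I = j} \<times> {J :: 'n set. card J = j}"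
  have "CARD(('m, 'n) minor_index) = card ?S"
    using type_definition.card[OF type_definition_minor_index] by simp
  also have "?S = (\<Union>j\<in>{1..min CARD('m) CARD('n)}. ?T j)"
  proof -
    have "card I \<le> CARD('m)" "card J \<le> CARD('n)" for I :: "'m set" and J :: "'n set"
      by (simp_all add: card_mono)
    then show ?thesis by auto metis
  qed
  also have "card \<dots> = (\<Sum>j=1..min CARD('m) CARD('n). card (?T j))"
    by (rule card_UN_disjoint) auto
  also have "\<dots> = (\<Sum>j=1..min CARD('m) CARD('n). (CARD('m) choose j) * (CARD('n) choose j))"
  proof (rule sum.cong[OF refl])
    fix j
    have "card {I :: 'm set. card I = j} = CARD('m) choose j"
      using n_subsets[of "UNIV :: 'm set" j] by simp
    moreover have "card {I :: 'n set. card I = j} = CARD('n) choose j"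
      using n_subsets[of "UNIV :: 'n set" j] by simp
    ultimately show "card (?T j) = (CARD('m) choose j) * (CARD('n) choose j)"
      by (simp add: card_cartesian_product)
  qed
  finally show ?thesis .
qed

type_synonym ('m, 'n) rmat = "real^'n^'m"

definition minors ::
    "('m::{finite,linorder}, 'n::{finite,linorder}) rmat \<Rightarrow> real^('m, 'n) minor_index" where
  "minors X = (\<chi> i. case Rep_minor_index i of (I, J) \<Rightarrow> minor (\<lambda>r c. X $ r $ c) I J)"

section \<open>Polyconvexity\<close>

text \<open>
  Functions into \<open>\<real> \<union> {+\<infinity>}\<close> are \<^typ>\<open>ereal\<close>-valued functions that omit \<open>-\<infinity>\<close>.
  Restricting to positive weights avoids the products \<open>0 \<cdot> \<infinity>\<close>.
\<close>

definition convex_ereal :: "('a::real_vector \<Rightarrow> ereal) \<Rightarrow> bool" where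
  "convex_ereal g \<longleftrightarrow> (\<forall>x. g x \<noteq> -\<infinity>) \<and>
     (\<forall>x y. \<forall>u>0. \<forall>v>0. u + v = 1 \<longrightarrow>
        g (u *\<^sub>R x + v *\<^sub>R y) \<le> ereal u * g x + ereal v * g y)"

definition polyconvex :: "(('m::{finite,linorder}, 'n::{finite,linorder}) rmat \<Rightarrow> ereal) \<Rightarrow> bool" where
  "polyconvex h \<longleftrightarrow> (\<exists>g. convex_ereal g \<and> h = g \<circ> minors)"

definition polyconvex_minorants ::
    "(('m::{finite,linorder}, 'n::{finite,linorder}) rmat \<Rightarrow> ereal) \<Rightarrow> (('m, 'n) rmat \<Rightarrow> ereal) set" where
  "polyconvex_minorants f = {h. polyconvex h \<and> (\<forall>Z. h Z \<le> f Z)}"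

text \<open>
  The supremum is meaningful only if \<open>f\<close> has a polyconvex minorant; on \<^typ>\<open>ereal\<close> the supremum
  of the empty family is \<open>-\<infinity>\<close>. For one-by-one matrices, \<open>f(z) = -z\<^sup>2\<close> on \<open>{z. z \<ge> 0}\<close> (and
  \<open>+\<infinity>\<close> elsewhere) has no polyconvex minorant, although its moment relaxation of order \<open>2\<close> with
  the single constraint \<open>z \<ge> 0\<close> attains the value \<open>f(0) = 0\<close> at \<open>0\<close>: feasibility forces \<open>y\<^sub>1 = 0\<close>, and
  \<open>z (a + b z)\<^sup>2\<close> with arbitrary \<open>a, b\<close> then forces \<open>y\<^sub>2 = 0\<close>.
\<close>

definition polyconvex_envelope ::
    "(('m::{finite,linorder}, 'n::{finite,linorder}) rmat \<Rightarrow> ereal) \<Rightarrow> ('m, 'n) rmat \<Rightarrow> ereal" where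
  "polyconvex_envelope f X = (SUP h\<in>polyconvex_minorants f. h X)"

definition polyconvex_at ::
    "(('m::{finite,linorder}, 'n::{finite,linorder}) rmat \<Rightarrow> ereal) \<Rightarrow> ('m, 'n) rmat \<Rightarrow> bool" where
  "polyconvex_at f X \<longleftrightarrow> polyconvex_envelope f X = f X"

section \<open>Polynomials in the entries of a matrix\<close>

type_synonym ('m, 'n) mexp = "('m \<times> 'n) \<Rightarrow>\<^sub>0 nat"
type_synonym ('m, 'n) mpol = "('m, 'n) mexp \<Rightarrow>\<^sub>0 real"

definition exp_deg :: "('m::finite, 'n::finite) mexp \<Rightarrow> nat" where
  "exp_deg a = (\<Sum>e\<in>UNIV. Poly_Mapping.lookup a e)"

text \<open>The zero polynomial has degree \<open>0\<close>.\<close>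

definition total_deg :: "('m::finite, 'n::finite) mpol \<Rightarrow> nat" where
  "total_deg q = Max (insert 0 (exp_deg ` Poly_Mapping.keys q))"

definition eval_mpol :: "('m::finite, 'n::finite) mpol \<Rightarrow> ('m, 'n) rmat \<Rightarrow> real" where
  "eval_mpol q Z = (\<Sum>a\<in>Poly_Mapping.keys q. Poly_Mapping.lookup q a * (\<Prod>(r, c)\<in>UNIV. (Z $ r $ c) ^ Poly_Mapping.lookup a (r, c)))"

definition var :: "'m \<Rightarrow> 'n \<Rightarrow> ('m, 'n) mpol" where
  "var r c = Poly_Mapping.single (Poly_Mapping.single (r, c) 1) 1"

definition minor_poly ::
    "('m::{finite,linorder}, 'n::{finite,linorder}) minor_index \<Rightarrow> ('m, 'n) mpol" where
  "minor_poly i = (case Rep_minor_index i of (I, J) \<Rightarrow> minor var I J)"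

definition sos_cone :: "nat \<Rightarrow> ('m::finite, 'n::finite) mpol set" where
  "sos_cone k = {\<sigma>. \<exists>qs. (\<forall>q\<in>set qs. total_deg q \<le> k) \<and> \<sigma> = (\<Sum>q\<leftarrow>qs. q * q)}"

section \<open>The moment relaxation\<close>

definition riesz :: "(('m::finite, 'n::finite) mexp \<Rightarrow> real) \<Rightarrow> ('m, 'n) mpol \<Rightarrow> real" where
  "riesz y q = (\<Sum>a\<in>Poly_Mapping.keys q. Poly_Mapping.lookup q a * y a)"

text \<open>
  A family indexed by the exponents of degree at most \<open>2 * k\<close> is extended by zero to all exponents.
\<close>

definition pseudo_moment_cone ::
    "nat \<Rightarrow> (nat \<Rightarrow> ('m::finite, 'n::finite) mpol) \<Rightarrow> nat \<Rightarrow> (('m, 'n) mexp \<Rightarrow> real) set" where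
  "pseudo_moment_cone s g k = {y.
     (\<forall>a. exp_deg a > 2 * k \<longrightarrow> y a = 0) \<and>
     (\<forall>\<sigma>\<in>sos_cone k. riesz y \<sigma> \<ge> 0) \<and>
     (\<forall>i\<in>{1..s}. \<forall>\<sigma>\<in>sos_cone k. total_deg (g i * \<sigma>) \<le> 2 * k \<longrightarrow> riesz y (g i * \<sigma>) \<ge> 0)}"

definition moment_relaxation ::
    "('m::{finite,linorder}, 'n::{finite,linorder}) mpol \<Rightarrow> nat \<Rightarrow> (nat \<Rightarrow> ('m, 'n) mpol) \<Rightarrow> nat
       \<Rightarrow> ('m, 'n) rmat \<Rightarrow> ereal" where
  "moment_relaxation F s g k X =
     (INF y\<in>{y \<in> pseudo_moment_cone s g k. riesz y 1 = 1 \<and>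
                 (\<forall>i. riesz y (minor_poly i) = minors X $ i)}. ereal (riesz y F))"

end

theory Submission
  imports Defs
begin

text \<open>
  Lifting the relaxation of order \<open>kstar\<close> from \<open>minors X\<close> to an arbitrary vector \<open>t\<close> of prescribed
  values yields a value function \<open>V\<close> of \<open>t\<close> that satisfies the convexity inequality, because
  pseudo-moments form a convex cone, and the point evaluation at \<open>Z\<close> shows \<open>V (minors Z) \<le> f Z\<close>.
  Since \<open>V\<close> may take the value \<open>-\<infinity>\<close>, it is not itself admissible in the polyconvex envelope; the
  maximum of \<open>V\<close> with a convex function representing some polyconvex minorant of \<open>f\<close> is.
  Hence the relaxation lies below the envelope, which lies below \<open>f\<close>.
  Finally, truncating pseudo-moments shows that the relaxations increase with the order, so all of
  them from \<open>kstar\<close> on are squeezed to \<open>f X\<close>.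
\<close>

section \<open>Degree and evaluation of polynomials\<close>

lemma total_deg_le_iff: "total_deg q \<le> d \<longleftrightarrow> (\<forall>a\<in>Poly_Mapping.keys q. exp_deg a \<le> d)"
  by (simp add: total_deg_def)

lemma exp_deg_le_total_deg: "a \<in> Poly_Mapping.keys q \<Longrightarrow> exp_deg a \<le> total_deg q"
  using total_deg_le_iff by blast

lemma exp_deg_zero [simp]: "exp_deg 0 = 0"
  by (simp add: exp_deg_def)

lemma exp_deg_add: "exp_deg (a + b) = exp_deg a + exp_deg b"
  by (simp add: exp_deg_def lookup_add sum.distrib)

lemma total_deg_0 [simp]: "total_deg 0 = 0"
  by (simp add: total_deg_def)

lemma total_deg_1 [simp]: "total_deg 1 = 0"
  by (simp add: total_deg_def)

lemma total_deg_uminus [simp]: "total_deg (- q) = total_deg q"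
  by (simp add: total_deg_def in_keys_iff Poly_Mapping.keys.rep_eq uminus_poly_mapping.rep_eq)

lemma total_deg_add_le: "total_deg p \<le> d \<Longrightarrow> total_deg q \<le> d \<Longrightarrow> total_deg (p + q) \<le> d"
  using keys_add[of p q] by (fastforce simp: total_deg_le_iff)

lemma total_deg_sum_le:
  "(\<And>x. x \<in> A \<Longrightarrow> total_deg (q x) \<le> d) \<Longrightarrow> total_deg (\<Sum>x\<in>A. q x) \<le> d"
  by (induction A rule: infinite_finite_induct) (auto intro: total_deg_add_le)

lemma total_deg_mult_le: "total_deg (p * q) \<le> total_deg p + total_deg q"
  unfolding total_deg_le_iff
proof
  fix a assume "a \<in> Poly_Mapping.keys (p * q)"
  then obtain b c where "a = b + c" "b \<in> Poly_Mapping.keys p" "c \<in> Poly_Mapping.keys q"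
    using keys_mult[of p q] by blast
  then show "exp_deg a \<le> total_deg p + total_deg q"
    by (simp add: exp_deg_add add_mono exp_deg_le_total_deg)
qed

lemma total_deg_prod_le: "total_deg (\<Prod>x\<in>A. q x) \<le> (\<Sum>x\<in>A. total_deg (q x))"
proof (induction A rule: infinite_finite_induct)
  case (insert x A)
  then show ?case
    using total_deg_mult_le[of "q x" "\<Prod>x\<in>A. q x"] by simp
qed auto

lemma total_deg_sos: "\<sigma> \<in> sos_cone k \<Longrightarrow> total_deg \<sigma> \<le> 2 * k"
proof -
  assume "\<sigma> \<in> sos_cone k"
  then obtain qs where "\<forall>q\<in>set qs. total_deg q \<le> k" "\<sigma> = (\<Sum>q\<leftarrow>qs. q * q)"
    unfolding sos_cone_def by blast
  moreover have "total_deg (\<Sum>q\<leftarrow>qs. q * q) \<le> 2 * k" if "\<forall>q\<in>set qs. total_deg q \<le> k" for qs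
    using that
  proof (induction qs)
    case (Cons q qs)
    then show ?case
      using total_deg_mult_le[of q q] by (auto intro!: total_deg_add_le)
  qed simp
  ultimately show ?thesis by simp
qed

lemma sos_cone_mono: "k \<le> l \<Longrightarrow> sos_cone k \<subseteq> sos_cone l"
  unfolding sos_cone_def using order_trans by blast

section \<open>Linearity of the Riesz functional\<close>

lemma riesz_eq_sum:
  assumes "finite A" "Poly_Mapping.keys q \<subseteq> A"
  shows "riesz y q = (\<Sum>a\<in>A. Poly_Mapping.lookup q a * y a)"
  unfolding riesz_def using assms
  by (intro sum.mono_neutral_left) (auto simp: in_keys_iff)

lemma riesz_add: "riesz y (p + q) = riesz y p + riesz y q"
proof -
  let ?A = "Poly_Mapping.keys p \<union> Poly_Mapping.keys q"
  have "riesz y (p + q) = (\<Sum>a\<in>?A. Poly_Mapping.lookup (p + q) a * y a)"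
    by (rule riesz_eq_sum) (simp_all add: keys_add)
  also have "\<dots> = (\<Sum>a\<in>?A. Poly_Mapping.lookup p a * y a) + (\<Sum>a\<in>?A. Poly_Mapping.lookup q a * y a)"
    by (simp add: lookup_add distrib_right sum.distrib)
  also have "\<dots> = riesz y p + riesz y q"
    by (simp add: riesz_eq_sum[where A = ?A])
  finally show ?thesis .
qed

lemma riesz_0 [simp]: "riesz y 0 = 0"
  by (simp add: riesz_def)

lemma riesz_single [simp]: "riesz y (Poly_Mapping.single a c) = c * y a"
  by (simp add: riesz_def)

lemma riesz_combination:
  "riesz (\<lambda>a. u * y a + v * z a) q = u * riesz y q + v * riesz z q"
  by (simp add: riesz_def sum.distrib sum_distrib_left algebra_simps)

lemma riesz_cong_deg:
  assumes "total_deg q \<le> d" "\<And>a. exp_deg a \<le> d \<Longrightarrow> y a = z a"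
  shows "riesz y q = riesz z q"
  unfolding riesz_def using assms by (intro sum.cong) (auto simp: total_deg_le_iff)

text \<open>Reduces additive statements about polynomials to single monomials.\<close>

lemma poly_mapping_add_induct [case_names zero single add]:
  fixes q :: "'a \<Rightarrow>\<^sub>0 'b::monoid_add"
  assumes "P 0" "\<And>a c. P (Poly_Mapping.single a c)" "\<And>p q. P p \<Longrightarrow> P q \<Longrightarrow> P (p + q)"
  shows "P q"
proof (induction q rule: Poly_Mapping.update_induct)
  case (update q a b)
  \<comment> \<open>The key \<open>a\<close> lies outside the support of \<open>q\<close>, so
    updating it amounts to adding a monomial.\<close>
  then have "Poly_Mapping.update a b q = q + Poly_Mapping.single a b"
    by (intro poly_mapping_eqI)
      (auto simp: lookup_update lookup_add lookup_single when_def in_keys_iff)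
  with update assms show ?case by metis
qed (fact assms(1))

section \<open>Point evaluation, as the Riesz functional of the moments of a Dirac measure\<close>

definition monom_value :: "('m::finite, 'n::finite) rmat \<Rightarrow> ('m, 'n) mexp \<Rightarrow> real" where
  "monom_value Z a = (\<Prod>(r, c)\<in>UNIV. (Z $ r $ c) ^ Poly_Mapping.lookup a (r, c))"

lemma eval_mpol_eq_riesz: "eval_mpol q Z = riesz (monom_value Z) q"
  by (simp add: eval_mpol_def riesz_def monom_value_def)

lemma monom_value_0 [simp]: "monom_value Z 0 = 1"
  by (simp add: monom_value_def case_prod_beta)

lemma monom_value_add: "monom_value Z (a + b) = monom_value Z a * monom_value Z b"
  by (simp add: monom_value_def case_prod_beta lookup_add power_add prod.distrib)

lemma monom_value_single: "monom_value Z (Poly_Mapping.single (r, c) 1) = Z $ r $ c"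
proof -
  have "monom_value Z (Poly_Mapping.single (r, c) 1) =
      (\<Prod>e\<in>UNIV. if e = (r, c) then Z $ fst e $ snd e else 1)"
    unfolding monom_value_def
    by (intro prod.cong) (auto simp: lookup_single when_def split: if_splits)
  then show ?thesis by (simp add: prod.delta)
qed

text \<open>Additivity in both factors leaves the case of two monomials, which is
  \<open>monom_value_add\<close>.\<close>

lemma eval_mpol_mult: "eval_mpol (p * q) Z = eval_mpol p Z * eval_mpol q Z"
proof (induction p rule: poly_mapping_add_induct)
  case (single a c)
  show ?case
    by (induction q rule: poly_mapping_add_induct)
      (simp_all add: eval_mpol_eq_riesz riesz_add distrib_left mult_single monom_value_add)
qed (simp_all add: eval_mpol_eq_riesz riesz_add distrib_right)

text \<open>The homomorphism form gives access to \<open>hom_det\<close>, which carries evaluation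
  through determinants.\<close>

lemma comm_ring_hom_eval_mpol: "comm_ring_hom (\<lambda>q. eval_mpol q Z)"
proof
  show "eval_mpol 1 Z = 1"
    unfolding eval_mpol_eq_riesz single_one[symmetric] riesz_single by simp
qed (simp_all add: eval_mpol_mult, simp_all add: eval_mpol_eq_riesz riesz_add)

lemma eval_mpol_sos_nonneg: "\<sigma> \<in> sos_cone k \<Longrightarrow> eval_mpol \<sigma> Z \<ge> 0"
proof -
  assume "\<sigma> \<in> sos_cone k"
  then obtain qs where "\<sigma> = (\<Sum>q\<leftarrow>qs. q * q)"
    unfolding sos_cone_def by blast
  moreover interpret comm_ring_hom "\<lambda>q. eval_mpol q Z"
    by (rule comm_ring_hom_eval_mpol)
  have "eval_mpol (\<Sum>q\<leftarrow>qs. q * q) Z \<ge> 0" for qs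
    by (induction qs) (simp_all add: hom_add eval_mpol_mult)
  ultimately show ?thesis by simp
qed

section \<open>Evaluation and degree of the minor polynomials\<close>

lemma eval_mpol_var: "eval_mpol (var r c) Z = Z $ r $ c"
  by (simp only: var_def eval_mpol_eq_riesz riesz_single monom_value_single mult_1)

lemma total_deg_var: "total_deg (var r c) = 1"
proof -
  have "exp_deg (Poly_Mapping.single (r, c) 1) = 1"
    by (simp add: exp_deg_def lookup_single when_def)
  then show ?thesis by (simp add: total_deg_def var_def)
qed

lemma eval_mpol_minor_poly: "eval_mpol (minor_poly i) Z = minors Z $ i"
proof -
  obtain I J where IJ: "Rep_minor_index i = (I, J)" by fastforce
  interpret comm_ring_hom "\<lambda>q. eval_mpol q Z"
    by (rule comm_ring_hom_eval_mpol)
  show ?thesis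
    unfolding minors_def minor_poly_def minor_def
    by (simp add: IJ flip: hom_det)
      (intro arg_cong[where f = Determinant.det] eq_matI; simp add: eval_mpol_var)
qed

text \<open>In the Leibniz expansion every term is, up to sign, a product of \<open>n\<close>
  entries.\<close>

lemma total_deg_det_le:
  fixes A :: "('m::finite, 'n::finite) mpol mat"
  assumes "A \<in> carrier_mat n n" "\<And>r c. r < n \<Longrightarrow> c < n \<Longrightarrow> total_deg (A $$ (r, c)) \<le> d"
  shows "total_deg (Determinant.det A) \<le> n * d"
  unfolding det_def'[OF assms(1)]
proof (rule total_deg_sum_le)
  fix p assume p: "p \<in> {p. p permutes {0..<n}}"
  have "total_deg (\<Prod>i = 0..<n. A $$ (i, p i)) \<le> (\<Sum>i = 0..<n. total_deg (A $$ (i, p i)))"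
    by (rule total_deg_prod_le)
  also have "\<dots> \<le> (\<Sum>i = 0..<n. d)"
    using p permutes_in_image by (intro sum_mono assms(2)) fastforce+
  finally show "total_deg (of_int (sign p) * (\<Prod>i = 0..<n. A $$ (i, p i))) \<le> n * d"
    by (simp add: sign_def)
qed

text \<open>The entries are variables, so the degree is at most the order of the minor, which counts
  the selected rows. Truncation at a degree of at least \<open>CARD('m)\<close> therefore cuts off
  no minor.\<close>

lemma total_deg_minor_poly_le:
  fixes i :: "('m::{finite,linorder}, 'n::{finite,linorder}) minor_index"
  shows "total_deg (minor_poly i) \<le> CARD('m)"
proof -
  obtain I J where IJ: "Rep_minor_index i = (I, J)" by fastforce
  then have "card I = card J" using Rep_minor_index[of i] by simp
  then have "total_deg (minor_poly i) \<le> card I * 1"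
    unfolding minor_poly_def IJ minor_def prod.case
    by (intro total_deg_det_le) (auto simp: total_deg_var)
  also have "\<dots> \<le> CARD('m)" by (simp add: card_mono)
  finally show ?thesis .
qed

section \<open>Pseudo-moments\<close>

lemma pseudo_moment_cone_combination:
  assumes "y \<in> pseudo_moment_cone s g k" "z \<in> pseudo_moment_cone s g k" "u \<ge> 0" "v \<ge> 0"
  shows "(\<lambda>a. u * y a + v * z a) \<in> pseudo_moment_cone s g k"
  using assms unfolding pseudo_moment_cone_def by (auto simp: riesz_combination)

text \<open>Zero above degree \<open>d\<close> matches the convention by which the cone encodes
  finite families.\<close>

definition truncate_moments :: "nat \<Rightarrow> (('m::finite, 'n::finite) mexp \<Rightarrow> real) \<Rightarrow> ('m, 'n) mexp \<Rightarrow> real" where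
  "truncate_moments d y a = (if exp_deg a \<le> d then y a else 0)"

lemma riesz_truncate_moments: "total_deg q \<le> d \<Longrightarrow> riesz (truncate_moments d y) q = riesz y q"
  by (erule riesz_cong_deg) (simp add: truncate_moments_def)

text \<open>Every polynomial tested by the cone has degree at most \<open>2 * k\<close>, by
  \<open>total_deg_sos\<close> or by the degree guard, so the cut-off changes no tested
  value.\<close>

lemma truncate_moments_in_cone:
  assumes "\<And>\<sigma>. \<sigma> \<in> sos_cone k \<Longrightarrow> riesz y \<sigma> \<ge> 0"
    and "\<And>i \<sigma>. i \<in> {1..s} \<Longrightarrow> \<sigma> \<in> sos_cone k \<Longrightarrow> total_deg (g i * \<sigma>) \<le> 2 * k \<Longrightarrow> riesz y (g i * \<sigma>) \<ge> 0"
  shows "truncate_moments (2 * k) y \<in> pseudo_moment_cone s g k"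
proof -
  have "truncate_moments (2 * k) y a = 0" if "exp_deg a > 2 * k" for a
    using that by (simp add: truncate_moments_def)
  with assms show ?thesis
    unfolding pseudo_moment_cone_def
    by (simp add: riesz_truncate_moments riesz_truncate_moments[OF total_deg_sos])
qed

section \<open>The relaxation as a function of the prescribed minors\<close>

definition moment_feasible ::
    "nat \<Rightarrow> (nat \<Rightarrow> ('m::{finite,linorder}, 'n::{finite,linorder}) mpol) \<Rightarrow> nat
       \<Rightarrow> real^('m, 'n) minor_index \<Rightarrow> (('m, 'n) mexp \<Rightarrow> real) set" where
  "moment_feasible s g k t =
     {y \<in> pseudo_moment_cone s g k. riesz y 1 = 1 \<and> (\<forall>i. riesz y (minor_poly i) = t $ i)}"

text \<open>If no \<open>y\<close> is feasible for \<open>t\<close>, the infimum is \<infinity>; if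
  the objective is unbounded below, it is -\<infinity>.\<close>

definition lifted_relaxation ::
    "('m::{finite,linorder}, 'n::{finite,linorder}) mpol \<Rightarrow> nat \<Rightarrow> (nat \<Rightarrow> ('m, 'n) mpol) \<Rightarrow> nat
       \<Rightarrow> real^('m, 'n) minor_index \<Rightarrow> ereal" where
  "lifted_relaxation F s g k t = (INF y\<in>moment_feasible s g k t. ereal (riesz y F))"

lemma moment_relaxation_eq_lifted:
  "moment_relaxation F s g k X = lifted_relaxation F s g k (minors X)"
  by (simp add: moment_relaxation_def lifted_relaxation_def moment_feasible_def)

lemma moment_feasible_combination:
  assumes "y \<in> moment_feasible s g k t" "z \<in> moment_feasible s g k t'" "u \<ge> 0" "v \<ge> 0" "u + v = 1"
  shows "(\<lambda>a. u * y a + v * z a) \<in> moment_feasible s g k (u *\<^sub>R t + v *\<^sub>R t')"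
  using assms by (auto simp: moment_feasible_def riesz_combination pseudo_moment_cone_combination)

text \<open>At \<open>Z\<close>, squares are nonnegative and each \<open>g i\<close> is nonnegative
  by assumption, hence so are the products tested by the cone.\<close>

lemma truncated_evaluation_feasible:
  fixes g :: "nat \<Rightarrow> ('m::{finite,linorder}, 'n::{finite,linorder}) mpol"
  assumes "\<forall>i\<in>{1..s}. eval_mpol (g i) Z \<ge> 0" "CARD('m) \<le> 2 * k"
  shows "truncate_moments (2 * k) (monom_value Z) \<in> moment_feasible s g k (minors Z)"
proof -
  interpret comm_ring_hom "\<lambda>q. eval_mpol q Z"
    by (rule comm_ring_hom_eval_mpol)
  have "truncate_moments (2 * k) (monom_value Z) \<in> pseudo_moment_cone s g k"
    using assms(1) unfolding eval_mpol_eq_riesz[symmetric]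
    by (intro truncate_moments_in_cone)
      (auto simp: eval_mpol_mult eval_mpol_sos_nonneg simp flip: eval_mpol_eq_riesz)
  moreover have "total_deg (minor_poly i :: ('m, 'n) mpol) \<le> 2 * k" for i
    using total_deg_minor_poly_le[of i] assms(2) by simp
  ultimately show ?thesis
    by (simp add: moment_feasible_def riesz_truncate_moments eval_mpol_minor_poly
        flip: eval_mpol_eq_riesz)
qed

text \<open>Every test of order \<open>k\<close> is also a test of order \<open>l\<close>, since
  both the cone of squares and the degree bound grow with the order.\<close>

lemma truncated_feasible:
  fixes g :: "nat \<Rightarrow> ('m::{finite,linorder}, 'n::{finite,linorder}) mpol"
  assumes "y \<in> moment_feasible s g l t" "k \<le> l" "CARD('m) \<le> 2 * k"
  shows "truncate_moments (2 * k) y \<in> moment_feasible s g k t"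
proof -
  have "truncate_moments (2 * k) y \<in> pseudo_moment_cone s g k"
    using assms(1,2) sos_cone_mono[of k l]
    by (intro truncate_moments_in_cone) (auto simp: moment_feasible_def pseudo_moment_cone_def)
  moreover have "total_deg (minor_poly i :: ('m, 'n) mpol) \<le> 2 * k" for i
    using total_deg_minor_poly_le[of i] assms(3) by simp
  ultimately show ?thesis
    using assms(1) by (simp add: moment_feasible_def riesz_truncate_moments)
qed

lemma lifted_relaxation_le_eval:
  fixes F :: "('m::{finite,linorder}, 'n::{finite,linorder}) mpol"
  assumes "\<forall>i\<in>{1..s}. eval_mpol (g i) Z \<ge> 0" "CARD('m) \<le> 2 * k" "total_deg F \<le> 2 * k"
  shows "lifted_relaxation F s g k (minors Z) \<le> ereal (eval_mpol F Z)"
  unfolding lifted_relaxation_def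
  by (rule INF_lower2[OF truncated_evaluation_feasible])
    (use assms in \<open>simp_all add: riesz_truncate_moments flip: eval_mpol_eq_riesz\<close>)

lemma lifted_relaxation_mono:
  fixes F :: "('m::{finite,linorder}, 'n::{finite,linorder}) mpol"
  assumes "k \<le> l" "CARD('m) \<le> 2 * k" "total_deg F \<le> 2 * k"
  shows "lifted_relaxation F s g k t \<le> lifted_relaxation F s g l t"
  unfolding lifted_relaxation_def
proof (rule INF_greatest)
  fix y assume "y \<in> moment_feasible s g l t"
  then show "(INF y\<in>moment_feasible s g k t. ereal (riesz y F)) \<le> ereal (riesz y F)"
    using assms by (intro INF_lower2[OF truncated_feasible]) (auto simp: riesz_truncate_moments)
qed

text \<open>Strict real bounds yield feasible \<open>y\<close> and \<open>z\<close> even where the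
  infimum is not attained or is -\<infinity>; their combination is then a candidate at the combined
  point.\<close>

lemma lifted_relaxation_convex_bound:
  assumes "u > 0" "v > 0" "u + v = 1"
    and "lifted_relaxation F s g k t < ereal a" "lifted_relaxation F s g k t' < ereal b"
  shows "lifted_relaxation F s g k (u *\<^sub>R t + v *\<^sub>R t') \<le> ereal (u * a + v * b)"
proof -
  obtain y z where "y \<in> moment_feasible s g k t" "riesz y F < a"
    and "z \<in> moment_feasible s g k t'" "riesz z F < b"
    using assms(4,5) by (auto simp: lifted_relaxation_def INF_less_iff)
  then show ?thesis
    unfolding lifted_relaxation_def using assms(1-3)
    by (intro INF_lower2[OF moment_feasible_combination[of y _ _ _ _ z]])
      (auto simp: riesz_combination intro!: add_mono mult_left_mono)
qed

lemma convex_ereal_max_lifted_relaxation: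
  assumes "convex_ereal h"
  shows "convex_ereal (\<lambda>t. max (lifted_relaxation F s g k t) (h t))" (is "convex_ereal ?M")
  unfolding convex_ereal_def
proof (intro conjI allI impI)
  fix t
  show "?M t \<noteq> -\<infinity>"
    using assms by (auto simp: convex_ereal_def max_def)
next
  fix t t' and u v :: real
  assume uv: "u > 0" "v > 0" "u + v = 1"
  have not_MInf: "?M t \<noteq> -\<infinity>" for t
    using assms by (auto simp: convex_ereal_def max_def)
  \<comment> \<open>An infinite maximum makes the right-hand side \<infinity>, because the weights
    are positive and the other maximum is not -\<infinity>. Only two real values need an
    argument.\<close>
  have "?M t = \<infinity> \<or> ?M t' = \<infinity> \<or> (\<exists>a b. ?M t = ereal a \<and> ?M t' = ereal b)"
    using not_MInf[of t] not_MInf[of t'] by (cases "?M t"; cases "?M t'") auto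
  then consider "?M t = \<infinity>" | "?M t' = \<infinity>" | a b where "?M t = ereal a" "?M t' = ereal b"
    by blast
  then show "?M (u *\<^sub>R t + v *\<^sub>R t') \<le> ereal u * ?M t + ereal v * ?M t'"
  proof cases
    case 3
    \<comment> \<open>The slack \<open>e\<close> turns the bounds \<open>a\<close> and
      \<open>b\<close> into strict ones; since \<open>u + v = 1\<close>, it costs exactly
      \<open>e\<close> in the combined bound.\<close>
    have "lifted_relaxation F s g k (u *\<^sub>R t + v *\<^sub>R t') \<le> ereal (u * a + v * b) + ereal e"
      if "e > 0" for e
    proof -
      have "lifted_relaxation F s g k t \<le> ereal a" "lifted_relaxation F s g k t' \<le> ereal b"
        using 3 by (metis max.cobounded1)+
      then have "lifted_relaxation F s g k t < ereal (a + e)" "lifted_relaxation F s g k t' < ereal (b + e)"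
        using that by (auto elim!: order_le_less_trans)
      then have "lifted_relaxation F s g k (u *\<^sub>R t + v *\<^sub>R t') \<le> ereal (u * (a + e) + v * (b + e))"
        by (rule lifted_relaxation_convex_bound[OF uv])
      also have "u * (a + e) + v * (b + e) = u * a + v * b + (u + v) * e"
        by (simp add: algebra_simps)
      finally show ?thesis using uv(3) by simp
    qed
    then have "lifted_relaxation F s g k (u *\<^sub>R t + v *\<^sub>R t') \<le> ereal (u * a + v * b)"
      by (rule ereal_le_epsilon2[rule_format])
    moreover have "h (u *\<^sub>R t + v *\<^sub>R t') \<le> ereal u * h t + ereal v * h t'"
      using assms uv by (simp add: convex_ereal_def)
    moreover have "ereal u * h t + ereal v * h t' \<le> ereal u * ereal a + ereal v * ereal b"
      using uv 3 by (intro add_mono ereal_mult_left_mono) (auto simp: max_def split: if_splits)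
    ultimately show ?thesis using 3 by auto
  qed (use uv not_MInf in \<open>auto simp: ereal_mult_eq_MInfty\<close>)
qed

section \<open>Comparison of relaxation, envelope and function\<close>

lemma polyconvex_envelope_le: "polyconvex_envelope f X \<le> f X"
  by (auto simp: polyconvex_envelope_def polyconvex_minorants_def intro: SUP_least)

text \<open>The convex \<open>h\<close> behind a minorant keeps the maximum away from -\<infinity>,
  and both members of the maximum stay below \<open>f\<close> along \<open>minors\<close>, so it
  competes in the supremum.\<close>

lemma lifted_relaxation_le_envelope:
  assumes "polyconvex_minorants f \<noteq> {}" "\<And>Z. lifted_relaxation F s g k (minors Z) \<le> f Z"
  shows "lifted_relaxation F s g k (minors X) \<le> polyconvex_envelope f X"
proof -
  obtain h where h: "convex_ereal h" "\<And>Z. h (minors Z) \<le> f Z"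
    using assms(1) by (auto simp: polyconvex_minorants_def polyconvex_def)
  let ?M = "\<lambda>t. max (lifted_relaxation F s g k t) (h t)"
  have "polyconvex (?M \<circ> minors)"
    unfolding polyconvex_def using convex_ereal_max_lifted_relaxation[OF h(1)] by blast
  then have "?M \<circ> minors \<in> polyconvex_minorants f"
    using h(2) assms(2) by (simp add: polyconvex_minorants_def)
  then have "(?M \<circ> minors) X \<le> polyconvex_envelope f X"
    unfolding polyconvex_envelope_def by (rule SUP_upper)
  then show ?thesis by simp
qed

theorem proposition3p1:
  fixes f :: "('m::{finite,linorder}, 'n::{finite,linorder}) rmat \<Rightarrow> ereal"
    and F :: "('m, 'n) mpol"
    and s :: nat
    and g :: "nat \<Rightarrow> ('m, 'n) mpol"
    and X :: "('m, 'n) rmat"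
    and kstar :: nat
  assumes "\<And>Z. f Z \<noteq> -\<infinity>"
    and "{Z. f Z < \<infinity>} = {Z. \<forall>i\<in>{1..s}. eval_mpol (g i) Z \<ge> 0}"
    and "\<And>Z. f Z < \<infinity> \<Longrightarrow> f Z = ereal (eval_mpol F Z)"
    and "polyconvex_minorants f \<noteq> {}"
    and "2 * kstar \<ge> Max {total_deg F, CARD('m), CARD('n)}"
    and "moment_relaxation F s g kstar X = f X"
  shows "(\<forall>k\<ge>kstar. moment_relaxation F s g k X = polyconvex_envelope f X \<and>
                     polyconvex_envelope f X = f X) \<and>
         polyconvex_at f X"
proof -
  have deg: "CARD('m) \<le> 2 * k" "total_deg F \<le> 2 * k" if "k \<ge> kstar" for k
    using assms(5) that by simp_all
  have le_f: "lifted_relaxation F s g k (minors Z) \<le> f Z" if "k \<ge> kstar" for k Z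
  \<comment> \<open>On the domain the evaluation at \<open>Z\<close> is feasible with objective
    value \<open>f Z\<close>; elsewhere the bound \<infinity> is trivial.\<close>
  proof (cases "f Z < \<infinity>")
    case True
    then show ?thesis
      using assms(2,3) deg[OF that] lifted_relaxation_le_eval[of s g Z k F] by force
  qed simp
  have "f X \<le> polyconvex_envelope f X"
    using lifted_relaxation_le_envelope[OF assms(4) le_f[OF order_refl], of X] assms(6)
    by (simp add: moment_relaxation_eq_lifted)
  then have envelope: "polyconvex_envelope f X = f X"
    by (simp add: antisym polyconvex_envelope_le)
  \<comment> \<open>Monotonicity in the order bounds the value below by that of order
    \<open>kstar\<close>, which is \<open>f X\<close>; \<open>le_f\<close> bounds it above.\<close>
  have "moment_relaxation F s g k X = f X" if "k \<ge> kstar" for k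
    using lifted_relaxation_mono[of kstar k F s g "minors X"] deg[OF order_refl] le_f[OF that, of X]
      that assms(6) by (simp add: moment_relaxation_eq_lifted)
  with envelope show ?thesis by (simp add: polyconvex_at_def)
qed

end
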